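(* Let $\nu>0$, $\alpha>2.5$ and $1.5<s<\alpha-1$. Let $(v^{(k)})_{k\in\mathbb{Z}^3}$ be a family of vectors in $\mathbb{C}^3$ (Fourier coefficients of the initial velocity) and suppose there exists a constant $C_0>0$ such that $|v^{(k)}|\le C_0|k|^{-s}$ for all $k\in\mathbb{Z}^3$. Then there exists a constant $C>C_0$, independent of $\mathcal{Z}$, such that the following holds for every finite subset $\mathcal{Z}\subset\mathbb{Z}^3$. Let $u^{(k)}:[0,\infty)\to\mathbb{C}^3$, $k\in\mathbb{Z}^3$, be differentiable functions, with components $u^{(k)}=(u_1^{(k)},u_2^{(k)},u_3^{(k)})$, such that: (1) $u^{(k)}(t)=0$ for all $k\notin\mathcal{Z}$ and $t\ge 0$; (2) $\sum_{j=1}^3 k_j u_j^{(k)}(t)=0$ for all $k\in\mathbb{Z}^3$ and $t\ge0$; (3) $u^{(-k)}(t)=\overline{u^{(k)}(t)}$ for all $k\in\mathbb{Z}^3$ and $t\ge0$; (4) $u^{(k)}(0)=v^{(k)}$ for all $k\in\mathcal{Z}$; (5) for all $k\in\mathcal{Z}$, $m\in\{1,2,3\}$ and $t\ge 0$, $$\frac{du_m^{(k)}}{dt}=\Bigl[\sum_{\substack{q+r=k\\ q,r\in\mathcal{Z}}}\ \sum_{j=1}^{3}\sum_{l=1}^{3}2\pi \mathrm{i}\Bigl(\frac{k_m k_l}{|k|^2}-\delta_{ml}\Bigr)k_j\,u_l^{(q)}u_j^{(r)}\Bigr]-4\pi^2\nu|k|^{\alpha}u_m^{(k)}.$$ Then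 $|u^{(k)}(t)|\le C|k|^{-s}$ for all $k\in\mathbb{Z}^3$ and all $t>0$.
   Context: Here $\mathrm{i}$ is the imaginary unit, $\delta_{ml}$ is the Kronecker delta, $|k|=\sqrt{k_1^2+k_2^2+k_3^2}$ for $k=(k_1,k_2,k_3)\in\mathbb{Z}^3$, and for $w\in\mathbb{C}^3$, $|w|$ is the Euclidean norm. For $k=0$ the quantity $|k|^{-s}$ is read as $+\infty$, so the bounds at $k=0$ are vacuous; if $0\in\mathcal{Z}$, the bracketed sum in (5) at $k=0$ is read as $0$ (every term has the factor $k_j=0$), so the equation at $k=0$ is $du^{(0)}/dt=0$. The system (5) is the finite-dimensional Galerkin approximation, associated to the finite set $\mathcal{Z}$ of Fourier modes, of the 3D incompressible Navier-Stokes equations with viscosity $\nu$ and period-one boundary conditions, after elimination of the pressure, with the Laplacian replaced by the operator whose Fourier symbol is $-4\pi^2|k|^\alpha$ ($\alpha=2$ would be the standard equations). The velocity is $u(x,t)=\sum_{k\in\mathcal{Z}}u^{(k)}(t)e^{2\pi \mathrm{i}k\cdot x}$; condition (2) is incompressibility and condition (3) says the velocity is real-valued. *)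

theory Defs
  imports "HOL-Analysis.Analysis"
begin

definition mode_norm :: "int ^ 3 \<Rightarrow> real" where
  "mode_norm k = sqrt (\<Sum>i\<in>UNIV. (real_of_int (k $ i))\<^sup>2)"

definition kronecker :: "3 \<Rightarrow> 3 \<Rightarrow> complex" where
  "kronecker m l = (if m = l then 1 else 0)"

text \<open>
  Component \<open>m\<close> of the right-hand side of the Galerkin system at mode \<open>k\<close>, for the Fourier
  coefficients \<open>w\<close> of the velocity at a fixed time. At \<open>k = 0\<close> both parts vanish: every
  term of the sum carries a factor \<open>k $ j = 0\<close>, and \<open>0 powr \<alpha> = 0\<close>.
\<close>

definition galerkin_rhs ::
    "real \<Rightarrow> real \<Rightarrow> (int ^ 3) set \<Rightarrow> (int ^ 3 \<Rightarrow> complex ^ 3) \<Rightarrow> int ^ 3 \<Rightarrow> 3 \<Rightarrow> complex" where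
  "galerkin_rhs \<nu> \<alpha> Z w k m =
     (\<Sum>(q, r) \<in> {(q, r). q \<in> Z \<and> r \<in> Z \<and> q + r = k}. \<Sum>j\<in>UNIV. \<Sum>l\<in>UNIV.
        2 * complex_of_real pi * \<i>
          * (of_int (k $ m) * of_int (k $ l) / complex_of_real ((mode_norm k)\<^sup>2) - kronecker m l)
          * of_int (k $ j) * (w q $ l) * (w r $ j))
     - complex_of_real (4 * pi\<^sup>2 * \<nu> * mode_norm k powr \<alpha>) * (w k $ m)"

end

theory Submission
  imports Defs
begin

text \<open>
  By incompressibility and reality, \<open>\<Sum>k. \<bar>u k\<bar>\<^sup>2\<close> does not increase, and since \<open>2 s > 3\<close> its initial
  value is bounded independently of the set of modes, say by \<open>E\<close>. Cauchy--Schwarz then bounds each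
  component of the convolution at mode \<open>k\<close> by a multiple of \<open>\<bar>k\<bar> E\<close>. With the damping rate
  \<open>4 \<pi>\<^sup>2 \<nu> \<bar>k\<bar> powr \<alpha>\<close>, Duhamel's formula gives \<open>\<bar>u k t\<bar> \<le> c (\<bar>v k\<bar> + E \<bar>k\<bar> powr (1 - \<alpha>) / \<nu>)\<close>, and
  \<open>1 - \<alpha> < - s\<close>. So the modes decouple and no trapping-region argument is needed.
\<close>

section \<open>Lattice sums\<close>

text \<open>Comparison with the p-series over the naturals, once for each sign of \<open>n\<close>.
  The \<open>max 1\<close> keeps the summand positive at \<open>n = 0\<close>: a nonzero lattice
  vector may have zero components, and the factor of such a component must still dominate a power of
  the norm.\<close>

lemma finite_sum_int_powr_bounded:
  fixes a :: real
  assumes "a > 1"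
  obtains M where "\<And>F :: int set. finite F \<Longrightarrow> (\<Sum>n\<in>F. (max 1 \<bar>real_of_int n\<bar>) powr (- a)) \<le> M"
proof -
  define g where "g n = (max 1 (real n)) powr (- a)" for n
  have "summable (\<lambda>n. real n powr (- a))"
    using assms by (simp add: summable_real_powr_iff)
  \<comment> \<open>The sequences differ only at \<open>n = 0\<close>, where
    \<open>0 powr (- a) = 0\<close> but \<open>g 0 = 1\<close>.\<close>
  moreover have "eventually (\<lambda>n. real n powr (- a) = g n) sequentially"
    using eventually_ge_at_top[of "1::nat"] by eventually_elim (simp add: g_def max_def)
  ultimately have sg: "summable g"
    using summable_cong by fast
  have half: "(\<Sum>n\<in>F. (max 1 \<bar>real_of_int n\<bar>) powr (- a)) \<le> suminf g"
    if "finite F" "inj_on (\<lambda>n. nat \<bar>n\<bar>) F" for F :: "int set"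
  proof -
    have "(\<Sum>n\<in>F. (max 1 \<bar>real_of_int n\<bar>) powr (- a)) = (\<Sum>n\<in>(\<lambda>n. nat \<bar>n\<bar>) ` F. g n)"
      by (subst sum.reindex[OF that(2)]) (simp add: g_def)
    also have "\<dots> \<le> suminf g"
      by (rule sum_le_suminf[OF sg]) (use that(1) in \<open>auto simp: g_def\<close>)
    finally show ?thesis .
  qed
  have "(\<Sum>n\<in>F. (max 1 \<bar>real_of_int n\<bar>) powr (- a)) \<le> suminf g + suminf g"
    if "finite F" for F :: "int set"
  proof -
    have "F = {n\<in>F. n \<ge> 0} \<union> {n\<in>F. n < 0}" by auto
    then have "(\<Sum>n\<in>F. (max 1 \<bar>real_of_int n\<bar>) powr (- a))
        = (\<Sum>n\<in>{n\<in>F. n \<ge> 0}. (max 1 \<bar>real_of_int n\<bar>) powr (- a))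
          + (\<Sum>n\<in>{n\<in>F. n < 0}. (max 1 \<bar>real_of_int n\<bar>) powr (- a))"
      using that by (subst sum.union_disjoint[symmetric]) auto
    also have "\<dots> \<le> suminf g + suminf g"
      using that by (intro add_mono half) (auto simp: inj_on_def)
    finally show ?thesis .
  qed
  then show thesis using that by blast
qed

lemma abs_component_le_mode_norm: "\<bar>real_of_int (k $ i)\<bar> \<le> mode_norm k"
  unfolding mode_norm_def
  by (rule real_le_rsqrt) (use member_le_sum[of i UNIV "\<lambda>i. (real_of_int (k $ i))\<^sup>2"] in simp)

lemma one_le_mode_norm:
  assumes "k \<noteq> 0"
  shows "1 \<le> mode_norm k"
proof -
  obtain i where "k $ i \<noteq> 0" using assms by (auto simp: vec_eq_iff)
  then have "1 \<le> \<bar>real_of_int (k $ i)\<bar>" by linarith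
  then show ?thesis using abs_component_le_mode_norm order_trans by blast
qed

text \<open>The exponent is shared equally among the three coordinates:
  \<open>mode_norm k powr (- p)\<close> is a product of three powers with exponent
  \<open>- p / 3\<close>, each at most the one-dimensional weight \<open>h\<close> of one component.
  Since \<open>p / 3 > 1\<close>, the one-dimensional bound applies to each factor.\<close>

lemma finite_sum_mode_norm_powr_bounded:
  fixes p :: real
  assumes "p > 3"
  obtains M where "\<And>F :: (int ^ 3) set. finite F \<Longrightarrow> 0 \<notin> F \<Longrightarrow> (\<Sum>k\<in>F. mode_norm k powr (- p)) \<le> M"
proof -
  define a where "a = p / 3"
  define h where "h n = (max 1 \<bar>real_of_int n\<bar>) powr (- a)" for n
  have h0: "h n \<ge> 0" for n by (simp add: h_def)
  obtain M where M: "\<And>F :: int set. finite F \<Longrightarrow> sum h F \<le> M"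
    unfolding h_def using finite_sum_int_powr_bounded[of a] assms by (auto simp: a_def)
  have M0: "0 \<le> M" using M[of "{}"] by simp
  have "(\<Sum>k\<in>F. mode_norm k powr (- p)) \<le> M * (M * M)"
    if F: "finite F" "0 \<notin> F" for F :: "(int ^ 3) set"
  proof -
    \<comment> \<open>All coordinates occurring in \<open>F\<close>, so that \<open>F\<close> embeds
      in the cube over \<open>B\<close>, on which the sum of products factorises.\<close>
    define B where "B = (\<Union>k\<in>F. range (($) k))"
    have fB: "finite B" using F by (auto simp: B_def)
    let ?e = "\<lambda>k :: int ^ 3. (k $ 1, k $ 2, k $ 3)"
    have inj: "inj_on ?e F" by (auto simp: inj_on_def vec_eq_iff forall_3)
    have "mode_norm k powr (- p) \<le> h (k $ 1) * (h (k $ 2) * h (k $ 3))" if "k \<in> F" for k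
    proof -
      have k1: "1 \<le> mode_norm k" using F that by (intro one_le_mode_norm) auto
      then have "mode_norm k powr (- a) \<le> h (k $ i)" for i
        unfolding h_def using assms abs_component_le_mode_norm[of k i]
        by (intro powr_mono2') (auto simp: a_def)
      then have "mode_norm k powr (- a) * (mode_norm k powr (- a) * mode_norm k powr (- a))
          \<le> h (k $ 1) * (h (k $ 2) * h (k $ 3))"
        by (intro mult_mono) (auto simp: h0)
      also have "mode_norm k powr (- a) * (mode_norm k powr (- a) * mode_norm k powr (- a))
          = mode_norm k powr (- p)"
        by (simp add: powr_add[symmetric] a_def)
      finally show ?thesis .
    qed
    then have "(\<Sum>k\<in>F. mode_norm k powr (- p)) \<le> (\<Sum>k\<in>F. h (k $ 1) * (h (k $ 2) * h (k $ 3)))"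
      by (rule sum_mono)
    also have "\<dots> = (\<Sum>(x, y, z)\<in>?e ` F. h x * (h y * h z))"
      by (subst sum.reindex[OF inj]) simp
    also have "\<dots> \<le> (\<Sum>(x, y, z)\<in>B \<times> B \<times> B. h x * (h y * h z))"
      using fB h0 by (intro sum_mono2) (auto simp: B_def)
    also have "\<dots> = sum h B * (sum h B * sum h B)"
      by (simp only: sum.cartesian_product[symmetric] sum_distrib_left[symmetric] sum_distrib_right[symmetric])
    also have "\<dots> \<le> M * (M * M)"
      using M[OF fB] M0 by (intro mult_mono) (auto intro!: sum_nonneg mult_nonneg_nonneg simp: h0)
    finally show ?thesis .
  qed
  then show thesis using that by blast
qed

section \<open>The nonlinear term at a fixed time\<close>

text \<open>The quadratic part is split off because it cancels in the energy balance and acts as a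
  bounded forcing in the equation of a single mode.\<close>

definition galerkin_nonlin ::
    "(int ^ 3) set \<Rightarrow> (int ^ 3 \<Rightarrow> complex ^ 3) \<Rightarrow> int ^ 3 \<Rightarrow> 3 \<Rightarrow> complex" where
  "galerkin_nonlin Z w k m =
     (\<Sum>(q, r) \<in> {(q, r). q \<in> Z \<and> r \<in> Z \<and> q + r = k}. \<Sum>j\<in>UNIV. \<Sum>l\<in>UNIV.
        2 * complex_of_real pi * \<i>
          * (of_int (k $ m) * of_int (k $ l) / complex_of_real ((mode_norm k)\<^sup>2) - kronecker m l)
          * of_int (k $ j) * (w q $ l) * (w r $ j))"

lemma galerkin_rhs_eq:
  "galerkin_rhs \<nu> \<alpha> Z w k m =
     galerkin_nonlin Z w k m - complex_of_real (4 * pi\<^sup>2 * \<nu> * mode_norm k powr \<alpha>) * (w k $ m)"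
  by (simp add: galerkin_rhs_def galerkin_nonlin_def)

lemma sum_over_convolution_pairs:
  fixes Z :: "(int ^ 3) set"
  shows "(\<Sum>(q, r) \<in> {(q, r). q \<in> Z \<and> r \<in> Z \<and> q + r = k}. f q r)
    = (\<Sum>q \<in> {q\<in>Z. k - q \<in> Z}. f q (k - q))"
proof -
  have "{(q, r). q \<in> Z \<and> r \<in> Z \<and> q + r = k} = (\<lambda>q. (q, k - q)) ` {q\<in>Z. k - q \<in> Z}"
    by (auto simp: image_iff algebra_simps)
  then show ?thesis
    by (simp add: sum.reindex inj_on_def)
qed

text \<open>Elimination of the pressure in Fourier form: a vector orthogonal to \<open>k\<close>
  annihilates the rank-one part, whatever \<open>c\<close> is. Hence the mode \<open>k = 0\<close>,
  where the denominator vanishes, needs no separate case.\<close>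

lemma leray_projection_pairing:
  fixes a :: "3 \<Rightarrow> complex"
  assumes "(\<Sum>m\<in>UNIV. of_int (k $ m) * a m) = 0"
  shows "(\<Sum>m\<in>UNIV. a m * (of_int (k $ m) * of_int (k $ l) / c - kronecker m l)) = - a l"
proof -
  have "(\<Sum>m\<in>UNIV. a m * (of_int (k $ m) * of_int (k $ l) / c - kronecker m l))
      = (\<Sum>m\<in>UNIV. of_int (k $ m) * a m) * (of_int (k $ l) / c) - (\<Sum>m\<in>UNIV. a m * kronecker m l)"
    by (simp add: sum_distrib_left sum_divide_distrib right_diff_distrib sum_subtractf mult_ac)
  also have "(\<Sum>m\<in>UNIV. a m * kronecker m l) = a l"
    by (simp add: kronecker_def if_distrib cong: if_cong)
  finally show ?thesis using assms by simp
qed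

text \<open>The nonlinear term does no work on the total energy. After the projection is removed,
  the pairing is a double sum of terms \<open>T k q\<close> that an involution of the index pairs
  sends to their negatives.\<close>

lemma sum_galerkin_nonlin_pairing:
  fixes w :: "int ^ 3 \<Rightarrow> complex ^ 3"
  assumes Z: "finite Z"
    and supp: "\<And>k. k \<notin> Z \<Longrightarrow> w k = 0"
    and div: "\<And>k. (\<Sum>j\<in>UNIV. of_int (k $ j) * (w k $ j)) = 0"
    and real: "\<And>k. w (- k) = (\<chi> m. cnj (w k $ m))"
  shows "(\<Sum>k\<in>Z. \<Sum>m\<in>UNIV. cnj (w k $ m) * galerkin_nonlin Z w k m) = 0"
proof -
  \<comment> \<open>\<open>Z\<close> need not be symmetric, but the involution negates indices.
    Since \<open>w\<close> vanishes outside \<open>Z\<close>, passing to the symmetric hull adds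
    only zero terms.\<close>
  define W where "W = Z \<union> uminus ` Z"
  have W: "finite W" "uminus ` W = W" "Z \<subseteq> W" using Z by (auto simp: W_def image_Un image_image)
  define T where "T k q = (\<Sum>j\<in>UNIV. of_int (k $ j) * (w (k - q) $ j))
      * (\<Sum>l\<in>UNIV. w q $ l * cnj (w k $ l))" for k q
  have pair: "(\<Sum>m\<in>UNIV. cnj (w k $ m) * galerkin_nonlin Z w k m)
      = - (2 * complex_of_real pi * \<i>) * (\<Sum>q\<in>W. T k q)" for k
  proof -
    let ?c = "2 * complex_of_real pi * \<i>"
    let ?P = "{q\<in>Z. k - q \<in> Z}"
    let ?X = "\<lambda>m l. of_int (k $ m) * of_int (k $ l) / complex_of_real ((mode_norm k)\<^sup>2) - kronecker m l"
    \<comment> \<open>As \<open>k\<close> is real, the conjugate of \<open>w k\<close> is orthogonal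
      to \<open>k\<close> too, as \<open>leray_projection_pairing\<close> requires.\<close>
    have "cnj (\<Sum>j\<in>UNIV. of_int (k $ j) * (w k $ j)) = 0" by (simp add: div)
    then have dc: "(\<Sum>j\<in>UNIV. of_int (k $ j) * cnj (w k $ j)) = 0" by simp
    have "(\<Sum>m\<in>UNIV. cnj (w k $ m) * galerkin_nonlin Z w k m)
      = (\<Sum>m\<in>UNIV. \<Sum>q\<in>?P. \<Sum>j\<in>UNIV. \<Sum>l\<in>UNIV.
          cnj (w k $ m) * (?c * ?X m l * of_int (k $ j) * (w q $ l) * (w (k - q) $ j)))"
      unfolding galerkin_nonlin_def sum_over_convolution_pairs by (simp only: sum_distrib_left)
    also have "\<dots> = (\<Sum>q\<in>?P. \<Sum>m\<in>UNIV. \<Sum>j\<in>UNIV. \<Sum>l\<in>UNIV.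
          cnj (w k $ m) * (?c * ?X m l * of_int (k $ j) * (w q $ l) * (w (k - q) $ j)))"
      by (rule sum.swap)
    also have "\<dots> = (\<Sum>q\<in>?P. - ?c * T k q)"
    \<comment> \<open>For fixed \<open>q\<close> the sum over \<open>m\<close> is moved innermost,
      where the projection acts as minus the identity.\<close>
    proof (rule sum.cong[OF refl])
      fix q
      have "(\<Sum>m\<in>UNIV. \<Sum>j\<in>UNIV. \<Sum>l\<in>UNIV.
          cnj (w k $ m) * (?c * ?X m l * of_int (k $ j) * (w q $ l) * (w (k - q) $ j)))
        = (\<Sum>j\<in>UNIV. \<Sum>m\<in>UNIV. \<Sum>l\<in>UNIV.
          cnj (w k $ m) * (?c * ?X m l * of_int (k $ j) * (w q $ l) * (w (k - q) $ j)))"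
        by (rule sum.swap)
      also have "\<dots> = (\<Sum>j\<in>UNIV. \<Sum>l\<in>UNIV. \<Sum>m\<in>UNIV.
          cnj (w k $ m) * (?c * ?X m l * of_int (k $ j) * (w q $ l) * (w (k - q) $ j)))"
        by (intro sum.cong[OF refl] sum.swap)
      also have "\<dots> = (\<Sum>j\<in>UNIV. \<Sum>l\<in>UNIV.
          (\<Sum>m\<in>UNIV. cnj (w k $ m) * ?X m l) * (?c * of_int (k $ j) * (w q $ l) * (w (k - q) $ j)))"
        unfolding sum_distrib_right by (intro sum.cong refl) (simp only: mult_ac)
      also have "\<dots> = (\<Sum>j\<in>UNIV. \<Sum>l\<in>UNIV.
          - cnj (w k $ l) * (?c * of_int (k $ j) * (w q $ l) * (w (k - q) $ j)))"
        by (simp only: leray_projection_pairing[OF dc])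
      also have "\<dots> = - ?c * T k q"
        unfolding T_def sum_product by (simp add: sum_distrib_left sum_negf mult_ac)
      finally show "(\<Sum>m\<in>UNIV. \<Sum>j\<in>UNIV. \<Sum>l\<in>UNIV.
          cnj (w k $ m) * (?c * ?X m l * of_int (k $ j) * (w q $ l) * (w (k - q) $ j))) = - ?c * T k q" .
    qed
    also have "\<dots> = (\<Sum>q\<in>W. - ?c * T k q)"
    proof (intro sum.mono_neutral_left ballI)
      fix q assume "q \<in> W - ?P"
      then have "w q = 0 \<or> w (k - q) = 0" using supp by blast
      then show "- ?c * T k q = 0" by (auto simp: T_def)
    qed (use W in auto)
    finally show ?thesis by (simp add: sum_distrib_left)
  qed
  \<comment> \<open>\<open>r = k - q\<close> is invariant under \<open>(k, q) \<mapsto> (- q, - k)\<close>, and \<open>k \<sqdot> w r = q \<sqdot> w r\<close> by incompressibility.\<close>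
  have anti: "T (- q) (- k) = - T k q" for k q
  proof -
    have "(\<Sum>j\<in>UNIV. of_int ((k - q) $ j) * (w (k - q) $ j)) = 0" by (rule div)
    then have "(\<Sum>j\<in>UNIV. of_int (k $ j) * (w (k - q) $ j)) = (\<Sum>j\<in>UNIV. of_int (q $ j) * (w (k - q) $ j))"
      by (simp add: left_diff_distrib sum_subtractf)
    then show ?thesis
      by (simp add: T_def real sum_negf mult_ac)
  qed
  \<comment> \<open>Negating both indices and exchanging the two sums turns the double sum into its
    own negative.\<close>
  have "(\<Sum>k\<in>W. \<Sum>q\<in>W. T k q) = (\<Sum>k\<in>uminus ` W. \<Sum>q\<in>uminus ` W. T k q)"
    by (simp add: W)
  also have "\<dots> = (\<Sum>k\<in>W. \<Sum>q\<in>W. T (- k) (- q))"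
    by (simp add: sum.reindex)
  also have "\<dots> = (\<Sum>q\<in>W. \<Sum>k\<in>W. T (- k) (- q))"
    by (rule sum.swap)
  also have "\<dots> = - (\<Sum>k\<in>W. \<Sum>q\<in>W. T k q)"
    by (simp add: anti sum_negf)
  finally have T0: "(\<Sum>k\<in>W. \<Sum>q\<in>W. T k q) = 0" by simp
  have "(\<Sum>k\<in>Z. \<Sum>q\<in>W. T k q) = (\<Sum>k\<in>W. \<Sum>q\<in>W. T k q)"
    using W by (intro sum.mono_neutral_left) (auto simp: T_def supp)
  then show ?thesis unfolding pair sum_distrib_left[symmetric] by (simp add: T0)
qed

text \<open>Only the energy enters, not the decay of single modes. The constant is
  \<open>2 * pi\<close> times 2 for the projection bracket times 9 for the pairs
  \<open>(j, l)\<close>; the factor \<open>k $ j\<close> gives one power of the norm.\<close>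

lemma norm_galerkin_nonlin_le:
  fixes w :: "int ^ 3 \<Rightarrow> complex ^ 3"
  assumes Z: "finite Z" and E: "(\<Sum>k\<in>Z. (norm (w k))\<^sup>2) \<le> E" and k: "k \<noteq> 0"
  shows "norm (galerkin_nonlin Z w k m) \<le> 36 * pi * mode_norm k * E"
proof -
  let ?P = "{q\<in>Z. k - q \<in> Z}"
  let ?n = "mode_norm k"
  have n: "1 \<le> ?n" using k by (rule one_le_mode_norm)
  have X: "norm (of_int (k $ m) * of_int (k $ l) / complex_of_real (?n\<^sup>2) - kronecker m l) \<le> 2" for l
  proof -
    have "\<bar>real_of_int (k $ m)\<bar> * \<bar>real_of_int (k $ l)\<bar> \<le> ?n * ?n"
      using n by (intro mult_mono abs_component_le_mode_norm) auto
    then have "norm (of_int (k $ m) * of_int (k $ l) / complex_of_real (?n\<^sup>2)) \<le> 1"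
      using n by (simp add: norm_divide norm_mult norm_power power2_eq_square)
    moreover have "norm (kronecker m l) \<le> 1" by (simp add: kronecker_def)
    ultimately show ?thesis
      by (smt (verit) norm_triangle_ineq4)
  qed
  have summand: "norm (2 * complex_of_real pi * \<i>
          * (of_int (k $ m) * of_int (k $ l) / complex_of_real (?n\<^sup>2) - kronecker m l)
          * of_int (k $ j) * (w q $ l) * (w r $ j))
      \<le> 2 * pi * 2 * ?n * norm (w q) * norm (w r)" for q r j l
  proof -
    have "norm (2 * complex_of_real pi * \<i>) = 2 * pi" by (simp add: norm_mult)
    moreover have "norm (of_int (k $ j) :: complex) \<le> ?n"
      using abs_component_le_mode_norm[of k j] by simp
    ultimately show ?thesis
      unfolding norm_mult[of _ "w r $ j"] norm_mult[of _ "w q $ l"] norm_mult[of _ "of_int (k $ j)"]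
        norm_mult[of "2 * complex_of_real pi * \<i>"]
      using n X[of l] Finite_Cartesian_Product.norm_nth_le[of "w q" l]
        Finite_Cartesian_Product.norm_nth_le[of "w r" j]
      by (intro mult_mono) simp_all
  qed
  have "norm (galerkin_nonlin Z w k m)
      \<le> (\<Sum>q\<in>?P. \<Sum>j\<in>(UNIV::3 set). \<Sum>l\<in>(UNIV::3 set). 2 * pi * 2 * ?n * norm (w q) * norm (w (k - q)))"
    unfolding galerkin_nonlin_def sum_over_convolution_pairs
    by (intro sum_norm_le summand)
  also have "\<dots> = 36 * pi * ?n * (\<Sum>q\<in>?P. norm (w q) * norm (w (k - q)))"
    by (simp add: sum_distrib_left mult_ac)
  \<comment> \<open>Each product is at most half the sum of the squares. Both \<open>q\<close> and
    \<open>k - q\<close> run injectively through part of \<open>Z\<close>, so each half contributes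
    at most \<open>E / 2\<close>.\<close>
  also have "(\<Sum>q\<in>?P. norm (w q) * norm (w (k - q))) \<le> E"
  proof -
    have "(\<Sum>q\<in>?P. norm (w q) * norm (w (k - q)))
        \<le> (\<Sum>q\<in>?P. (norm (w q))\<^sup>2 / 2 + (norm (w (k - q)))\<^sup>2 / 2)"
      proof (rule sum_mono)
      fix q
      show "norm (w q) * norm (w (k - q)) \<le> (norm (w q))\<^sup>2 / 2 + (norm (w (k - q)))\<^sup>2 / 2"
        using sum_squares_bound[of "norm (w q)" "norm (w (k - q))"] by simp
    qed
    also have "\<dots> = (\<Sum>q\<in>?P. (norm (w q))\<^sup>2) / 2 + (\<Sum>q\<in>?P. (norm (w (k - q)))\<^sup>2) / 2"
      by (simp add: sum.distrib sum_divide_distrib)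
    also have "(\<Sum>q\<in>?P. (norm (w (k - q)))\<^sup>2) = (\<Sum>q\<in>(\<lambda>q. k - q) ` ?P. (norm (w q))\<^sup>2)"
      by (subst sum.reindex) (auto simp: inj_on_def)
    also have "\<dots> \<le> (\<Sum>q\<in>Z. (norm (w q))\<^sup>2)"
      using Z by (intro sum_mono2) auto
    also have "(\<Sum>q\<in>?P. (norm (w q))\<^sup>2) \<le> (\<Sum>q\<in>Z. (norm (w q))\<^sup>2)"
      using Z by (intro sum_mono2) auto
    finally show ?thesis using E by simp
  qed
  finally show ?thesis using n by (simp add: mult_left_mono)
qed

section \<open>Evolution\<close>

text \<open>The integrating factor \<open>exp (lam * t)\<close> removes the damping, and a mean
  value inequality against the antiderivative \<open>\<phi>\<close> of
  \<open>B * exp (lam * t)\<close> takes the place of the Duhamel integral.\<close>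

lemma norm_damped_le:
  fixes f g :: "real \<Rightarrow> complex" and B lam :: real
  assumes der: "\<And>t. t \<ge> 0 \<Longrightarrow> (f has_vector_derivative g t - complex_of_real lam * f t) (at t within {0..})"
    and g: "\<And>t. t \<ge> 0 \<Longrightarrow> norm (g t) \<le> B" and "lam > 0" "t \<ge> 0"
  shows "norm (f t) \<le> norm (f 0) + B / lam"
proof -
  have B: "B \<ge> 0" using g[of 0] norm_ge_zero[of "g 0"] by linarith
  define F where "F t = exp (lam * t) *\<^sub>R f t" for t
  define \<phi> where "\<phi> t = B / lam * exp (lam * t)" for t
  have dF: "(F has_vector_derivative exp (lam * t) *\<^sub>R g t) (at t within {0..})" if "t \<ge> 0" for t
  proof -
    have e: "((\<lambda>t. exp (lam * t)) has_real_derivative exp (lam * t) * lam) (at t within {0..})"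
      by (auto intro!: derivative_eq_intros)
    show ?thesis
      unfolding F_def
      by (rule has_vector_derivative_eq_rhs[OF has_vector_derivative_scaleR[OF e der[OF that]]])
        (simp add: scaleR_conv_of_real algebra_simps)
  qed
  have d\<phi>: "(\<phi> has_vector_derivative B * exp (lam * t)) (at t)" for t
    unfolding \<phi>_def has_real_derivative_iff_has_vector_derivative[symmetric]
    using \<open>lam > 0\<close> by (auto intro!: derivative_eq_intros)
  have "norm (F t - F 0) \<le> \<phi> t - \<phi> 0"
  proof (cases "t = 0")
    case False
    show ?thesis
    proof (rule differentiable_bound_general)
      show "0 < t" using False \<open>t \<ge> 0\<close> by simp
      show "continuous_on {0..t} F"
        by (rule continuous_on_subset[of "{0..}"])
          (auto intro!: continuous_on_vector_derivative dF)
      show "continuous_on {0..t} \<phi>"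
        unfolding \<phi>_def by (intro continuous_intros)
      fix x :: real assume x: "0 < x" "x < t"
      have "at x within {0..} = at x"
        using x by (intro at_within_interior) simp
      then show "(F has_vector_derivative exp (lam * x) *\<^sub>R g x) (at x)"
        using dF[of x] x by simp
      show "(\<phi> has_vector_derivative B * exp (lam * x)) (at x)" by (rule d\<phi>)
      show "norm (exp (lam * x) *\<^sub>R g x) \<le> B * exp (lam * x)"
        using g[of x] x by simp
    qed
  qed simp
  then have "norm (F t) \<le> norm (f 0) + \<phi> t - \<phi> 0"
    using norm_triangle_ineq2[of "F t" "F 0"] by (simp add: F_def)
  also have "\<dots> \<le> norm (f 0) + \<phi> t"
    using B \<open>lam > 0\<close> by (simp add: \<phi>_def)
  \<comment> \<open>Since \<open>exp (lam * t) \<ge> 1\<close>, the factor may be attached to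
    \<open>norm (f 0)\<close>; the decay of the initial value is given up.\<close>
  also have "\<dots> \<le> exp (lam * t) * (norm (f 0) + B / lam)"
    using \<open>lam > 0\<close> \<open>t \<ge> 0\<close> by (simp add: \<phi>_def distrib_left mult_ac mult_le_cancel_left1)
  finally have "exp (lam * t) * norm (f t) \<le> exp (lam * t) * (norm (f 0) + B / lam)"
    by (simp add: F_def)
  then show ?thesis by simp
qed

text \<open>In the time derivative of the energy the nonlinear pairing vanishes and the damping
  contributes a nonpositive term.\<close>

lemma galerkin_energy_le:
  fixes u :: "int ^ 3 \<Rightarrow> real \<Rightarrow> complex ^ 3"
  assumes Z: "finite Z" and nu: "\<nu> \<ge> 0" and t: "t \<ge> 0"
    and supp: "\<And>k t. k \<notin> Z \<Longrightarrow> t \<ge> 0 \<Longrightarrow> u k t = 0"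
    and div: "\<And>k t. t \<ge> 0 \<Longrightarrow> (\<Sum>j\<in>UNIV. of_int (k $ j) * (u k t $ j)) = 0"
    and real: "\<And>k t. t \<ge> 0 \<Longrightarrow> u (- k) t = (\<chi> m. cnj (u k t $ m))"
    and ode: "\<And>k m t. k \<in> Z \<Longrightarrow> t \<ge> 0 \<Longrightarrow> ((\<lambda>\<tau>. u k \<tau> $ m) has_vector_derivative
                galerkin_rhs \<nu> \<alpha> Z (\<lambda>q. u q t) k m) (at t within {0..})"
  shows "(\<Sum>k\<in>Z. (norm (u k t))\<^sup>2) \<le> (\<Sum>k\<in>Z. (norm (u k 0))\<^sup>2)"
proof -
  define G where "G t = (\<Sum>k\<in>Z. \<Sum>m\<in>UNIV. (u k t $ m) \<bullet> (u k t $ m))" for t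
  have G_eq: "G t = (\<Sum>k\<in>Z. (norm (u k t))\<^sup>2)" for t
    by (simp add: G_def power2_norm_eq_inner inner_vec_def)
  define D where "D t = (\<Sum>k\<in>Z. \<Sum>m\<in>UNIV. 2 * (u k t $ m \<bullet> galerkin_rhs \<nu> \<alpha> Z (\<lambda>q. u q t) k m))" for t
  have dG: "(G has_real_derivative D t) (at t within {0..})" if "t \<ge> 0" for t
  proof -
    have "((\<lambda>t. (u k t $ m) \<bullet> (u k t $ m)) has_vector_derivative
        2 * (u k t $ m \<bullet> galerkin_rhs \<nu> \<alpha> Z (\<lambda>q. u q t) k m)) (at t within {0..})"
      if "k \<in> Z" for k m
      using bounded_bilinear.has_vector_derivative[OF bounded_bilinear_inner
          ode[OF that \<open>t \<ge> 0\<close>, of m] ode[OF that \<open>t \<ge> 0\<close>, of m]]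
      by (simp add: inner_commute)
    then show ?thesis
      unfolding G_def D_def has_real_derivative_iff_has_vector_derivative
      by (intro has_vector_derivative_sum)
  qed
  have D: "D t \<le> 0" if "t \<ge> 0" for t
  proof -
    let ?w = "\<lambda>q. u q t"
    let ?lam = "\<lambda>k. 4 * pi\<^sup>2 * \<nu> * mode_norm k powr \<alpha>"
    \<comment> \<open>The real inner product on the complex numbers is rewritten so that the complex
      pairing identity applies under \<open>Re\<close>.\<close>
    have inner: "x \<bullet> y = Re (cnj x * y)" for x y :: complex
      by (simp add: inner_complex_def)
    have "D t = 2 * Re (\<Sum>k\<in>Z. \<Sum>m\<in>UNIV. cnj (?w k $ m) * galerkin_nonlin Z ?w k m)
        - 2 * (\<Sum>k\<in>Z. \<Sum>m\<in>UNIV. ?lam k * (?w k $ m \<bullet> ?w k $ m))"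
      unfolding D_def galerkin_rhs_eq
      by (simp add: inner_diff_right sum_subtractf sum_distrib_left inner algebra_simps)
    also have "\<dots> = - 2 * (\<Sum>k\<in>Z. \<Sum>m\<in>UNIV. ?lam k * (?w k $ m \<bullet> ?w k $ m))"
      using sum_galerkin_nonlin_pairing[of Z ?w, OF Z] supp div real that by simp
    also have "\<dots> \<le> 0"
      using nu by (auto intro!: sum_nonneg mult_nonneg_nonneg)
    finally show ?thesis .
  qed
  have "G t \<le> G 0"
  proof (rule DERIV_nonpos_imp_decreasing_open[of 0 t G])
    show "0 \<le> t" by (rule t)
    show "continuous_on {0..t} G"
      by (rule continuous_on_subset[of "{0..}"]) (auto intro!: DERIV_continuous_on dG)
    fix x :: real assume x: "0 < x" "x < t"
    have "at x within {0..} = at x"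
      using x by (intro at_within_interior) simp
    then show "\<exists>y. (G has_real_derivative y) (at x) \<and> y \<le> 0"
      using dG[of x] D[of x] x by auto
  qed
  then show ?thesis by (simp add: G_eq)
qed

section \<open>Decay of every mode, uniformly in the set of modes\<close>

theorem mainTheorem1:
  fixes \<nu> \<alpha> s C\<^sub>0 :: real and v :: "int ^ 3 \<Rightarrow> complex ^ 3"
  assumes "\<nu> > 0" and "\<alpha> > 2.5" and "1.5 < s" and "s < \<alpha> - 1"
    and "C\<^sub>0 > 0"
    \<comment> \<open>\<open>0 powr (- s) = 0\<close>, whereas the bound at \<open>k = 0\<close> is meant to be vacuous\<close>
    and "\<forall>k. k \<noteq> 0 \<longrightarrow> norm (v k) \<le> C\<^sub>0 * mode_norm k powr (- s)"
  shows "\<exists>C > C\<^sub>0. \<forall>(Z :: (int ^ 3) set) (u :: int ^ 3 \<Rightarrow> real \<Rightarrow> complex ^ 3).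
           finite Z
           \<longrightarrow> (\<forall>k. u k differentiable_on {0..})
           \<longrightarrow> (\<forall>k t. k \<notin> Z \<longrightarrow> t \<ge> 0 \<longrightarrow> u k t = 0)
           \<longrightarrow> (\<forall>k t. t \<ge> 0 \<longrightarrow> (\<Sum>j\<in>UNIV. of_int (k $ j) * (u k t $ j)) = 0)
           \<longrightarrow> (\<forall>k t. t \<ge> 0 \<longrightarrow> u (- k) t = (\<chi> m. cnj (u k t $ m)))
           \<longrightarrow> (\<forall>k\<in>Z. u k 0 = v k)
           \<longrightarrow> (\<forall>k\<in>Z. \<forall>m. \<forall>t\<ge>0.
                  ((\<lambda>\<tau>. u k \<tau> $ m) has_vector_derivative
                     galerkin_rhs \<nu> \<alpha> Z (\<lambda>q. u q t) k m) (at t within {0..}))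
           \<longrightarrow> (\<forall>k t. k \<noteq> 0 \<longrightarrow> t > 0 \<longrightarrow> norm (u k t) \<le> C * mode_norm k powr (- s))"
proof -
  obtain M where M: "\<And>F :: (int ^ 3) set. finite F \<Longrightarrow> 0 \<notin> F
      \<Longrightarrow> (\<Sum>k\<in>F. mode_norm k powr (- (2 * s))) \<le> M"
    using finite_sum_mode_norm_powr_bounded[of "2 * s"] \<open>1.5 < s\<close> by auto
  have M0: "0 \<le> M" using M[of "{}"] by simp
  \<comment> \<open>Bounds the initial energy for every \<open>Z\<close>. The decay hypothesis says
    nothing about \<open>v 0\<close>, which therefore enters separately.\<close>
  define E where "E = (norm (v 0))\<^sup>2 + C\<^sub>0\<^sup>2 * M"
  have E0: "0 \<le> E" using M0 by (simp add: E_def)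
  \<comment> \<open>The forcing constant over the damping constant, with the powers of
    \<open>mode_norm k\<close> left out.\<close>
  define A where "A = 36 * pi * E / (4 * pi\<^sup>2 * \<nu>)"
  have A0: "0 \<le> A" using E0 \<open>\<nu> > 0\<close> by (simp add: A_def)
  have initial_energy: "(\<Sum>k\<in>Z. (norm (v k))\<^sup>2) \<le> E" if "finite Z" for Z
  proof -
    have "(\<Sum>k\<in>Z. (norm (v k))\<^sup>2) \<le> (\<Sum>k\<in>insert 0 (Z - {0}). (norm (v k))\<^sup>2)"
      using that by (intro sum_mono2) auto
    also have "\<dots> = (norm (v 0))\<^sup>2 + (\<Sum>k\<in>Z - {0}. (norm (v k))\<^sup>2)"
      using that by (subst sum.insert) auto
    also have "(\<Sum>k\<in>Z - {0}. (norm (v k))\<^sup>2) \<le> (\<Sum>k\<in>Z - {0}. C\<^sub>0\<^sup>2 * mode_norm k powr (- (2 * s)))"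
    proof (rule sum_mono)
      fix k assume "k \<in> Z - {0}"
      then have "(norm (v k))\<^sup>2 \<le> (C\<^sub>0 * mode_norm k powr (- s))\<^sup>2"
        using assms by (intro power_mono) auto
      also have "\<dots> = C\<^sub>0\<^sup>2 * mode_norm k powr (- (2 * s))"
        by (simp add: power_mult_distrib power2_eq_square powr_add[symmetric])
      finally show "(norm (v k))\<^sup>2 \<le> C\<^sub>0\<^sup>2 * mode_norm k powr (- (2 * s))" .
    qed
    also have "\<dots> \<le> C\<^sub>0\<^sup>2 * M"
      using M[of "Z - {0}"] that by (simp add: sum_distrib_left[symmetric] mult_left_mono)
    finally show ?thesis by (simp add: E_def)
  qed
  show ?thesis
  \<comment> \<open>The factor 3 pays for passing from components to the Euclidean norm, and makes
    the constant strictly exceed \<open>C\<^sub>0\<close>.\<close>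
  proof (intro exI[of _ "3 * (C\<^sub>0 + A)"] conjI allI impI)
    show "C\<^sub>0 < 3 * (C\<^sub>0 + A)" using A0 \<open>C\<^sub>0 > 0\<close> by simp
    fix Z :: "(int ^ 3) set" and u :: "int ^ 3 \<Rightarrow> real \<Rightarrow> complex ^ 3" and k :: "int ^ 3" and t :: real
    assume Z: "finite Z"
      and supp: "\<forall>k t. k \<notin> Z \<longrightarrow> t \<ge> 0 \<longrightarrow> u k t = 0"
      and div: "\<forall>k t. t \<ge> 0 \<longrightarrow> (\<Sum>j\<in>UNIV. of_int (k $ j) * (u k t $ j)) = 0"
      and real: "\<forall>k t. t \<ge> 0 \<longrightarrow> u (- k) t = (\<chi> m. cnj (u k t $ m))"
      and init: "\<forall>k\<in>Z. u k 0 = v k"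
      and ode: "\<forall>k\<in>Z. \<forall>m. \<forall>t\<ge>0. ((\<lambda>\<tau>. u k \<tau> $ m) has_vector_derivative
                  galerkin_rhs \<nu> \<alpha> Z (\<lambda>q. u q t) k m) (at t within {0..})"
      and k: "k \<noteq> 0" and t: "t > 0"
    have n: "1 \<le> mode_norm k" using k by (rule one_le_mode_norm)
    show "norm (u k t) \<le> 3 * (C\<^sub>0 + A) * mode_norm k powr (- s)"
    proof (cases "k \<in> Z")
      case False
      then show ?thesis using supp t A0 \<open>C\<^sub>0 > 0\<close> by simp
    next
      case True
      have energy: "(\<Sum>k\<in>Z. (norm (u k \<tau>))\<^sup>2) \<le> E" if "\<tau> \<ge> 0" for \<tau>
      proof -
        have "(\<Sum>k\<in>Z. (norm (u k \<tau>))\<^sup>2) \<le> (\<Sum>k\<in>Z. (norm (u k 0))\<^sup>2)"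
          by (rule galerkin_energy_le[where \<nu> = \<nu> and \<alpha> = \<alpha>])
            (use Z supp div real ode that \<open>\<nu> > 0\<close> in auto)
        also have "\<dots> \<le> E" using initial_energy[OF Z] init by simp
        finally show ?thesis .
      qed
      define lam where "lam = 4 * pi\<^sup>2 * \<nu> * mode_norm k powr \<alpha>"
      have "lam > 0" using \<open>\<nu> > 0\<close> n by (simp add: lam_def)
      have comp: "norm (u k t $ m) \<le> (C\<^sub>0 + A) * mode_norm k powr (- s)" for m
      proof -
        have "norm (u k t $ m) \<le> norm (u k 0 $ m) + 36 * pi * mode_norm k * E / lam"
        proof (rule norm_damped_le[where f = "\<lambda>t. u k t $ m"])
          fix \<tau> :: real assume "\<tau> \<ge> 0"
          then show "((\<lambda>t. u k t $ m) has_vector_derivative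
              galerkin_nonlin Z (\<lambda>q. u q \<tau>) k m - complex_of_real lam * (u k \<tau> $ m)) (at \<tau> within {0..})"
            using ode True by (simp add: galerkin_rhs_eq lam_def)
          show "norm (galerkin_nonlin Z (\<lambda>q. u q \<tau>) k m) \<le> 36 * pi * mode_norm k * E"
            using \<open>\<tau> \<ge> 0\<close> by (intro norm_galerkin_nonlin_le Z energy k)
        qed (use \<open>lam > 0\<close> t in auto)
        also have "norm (u k 0 $ m) \<le> C\<^sub>0 * mode_norm k powr (- s)"
          using init True assms k Finite_Cartesian_Product.norm_nth_le[of "v k" m] order_trans by fastforce
        also have "36 * pi * mode_norm k * E / lam = A * mode_norm k powr (1 - \<alpha>)"
          using n by (simp add: A_def lam_def powr_diff field_simps)
        \<comment> \<open>Here \<open>s < \<alpha> - 1\<close> enters: for a norm of at least 1 the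
          exponent \<open>1 - \<alpha>\<close> may be raised to \<open>- s\<close>.\<close>
        also have "\<dots> \<le> A * mode_norm k powr (- s)"
          using n A0 \<open>s < \<alpha> - 1\<close> by (intro mult_left_mono powr_mono) auto
        finally show ?thesis by (simp add: distrib_right)
      qed
      have "norm (u k t) \<le> (\<Sum>m\<in>UNIV. norm (u k t $ m))"
        unfolding norm_vec_def by (rule L2_set_le_sum) simp
      also have "\<dots> \<le> (\<Sum>m\<in>(UNIV :: 3 set). (C\<^sub>0 + A) * mode_norm k powr (- s))"
        by (rule sum_mono) (rule comp)
      finally show ?thesis by (simp add: algebra_simps)
    qed
  qed
qed

end
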